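(* Let $\Gamma\subset\mathbb{C}$ be a lattice, $\mu\in\mathbb{R}\setminus\{0\}$, $\omega_0\in\tfrac12\Gamma^*$, $\Gamma'=\{\omega\in\Gamma^*:\ |\omega+\omega_0|^2=\mu^2\}$, and let $a_\omega\in\mathbb{C}$ for $\omega\in\Gamma'$. Let $$\lambda_1=\sum_{\omega\in\Gamma'}a_\omega\,e^{\mathbf{i}\langle\omega+\omega_0,z\rangle},\qquad \lambda_2=-\sum_{\omega\in\Gamma'}\tfrac{1}{\mu}\,a_\omega\,(\omega+\omega_0)\,e^{\mathbf{i}\langle\omega+\omega_0,z\rangle},$$ and let $f:\mathbb{C}\to\mathbb{R}^3=\operatorname{Im}\mathbb{H}$ be the Dirac surface with differential $$df=(\mathbf{j}\lambda_1^2+\lambda_1\bar\lambda_2)\,dz+(\mathbf{j}\lambda_2^2-\bar\lambda_1\lambda_2)\,d\bar z .$$ Then $f$ closes to a torus (i.e. $f$ is $\Gamma$-periodic and so descends to $\mathbb{C}/\Gamma$) if and only if the following conditions hold: $$(1)\ \sum_{\omega\in\Gamma'}|a_\omega|^2(\omega+\omega_0)=0,$$ $$(2)\ \sum_{\omega\in\Gamma'}a_\omega\,a_{-\omega-2\omega_0}=0,$$ $$(3)\ \sum_{\omega\in\Gamma'}a_\omega\,a_{-\omega-2\omega_0}\,(\omega+\omega_0)^2=0.$$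
   Context: $\mathbb{H}$ denotes the quaternions with units $\mathbf{i},\mathbf{j},\mathbf{k}$; $\mathbb{R}^3$ is identified with $\operatorname{Im}\mathbb{H}=\{a\in\mathbb{H}:a+\bar a=0\}$, and $\mathbb{C}=\operatorname{span}_{\mathbb{R}}(1,\mathbf{i})\subset\mathbb{H}$. Here $z$ is the standard coordinate on $\mathbb{C}$ and $\langle w,z\rangle=\operatorname{Re}(w\bar z)$ is the standard Euclidean inner product on $\mathbb{C}\cong\mathbb{R}^2$. The dual lattice of $\Gamma$ is $\Gamma^*=\{\omega\in\mathbb{C}:\langle\omega,\gamma\rangle\in2\pi\mathbb{Z}\text{ for all }\gamma\in\Gamma\}$. Note that $-\omega-2\omega_0\in\Gamma'$ whenever $\omega\in\Gamma'$. With $\lambda=\lambda_1+\mathbf{j}\lambda_2$, the formula for $df$ is $df=\bar\lambda\,\mathbf{j}\,dz\,\lambda$, and $\lambda$ solves $2\mathbf{i}\,\partial\lambda_2=\mu\lambda_1$, $2\mathbf{i}\,\bar\partial\lambda_1=\mu\lambda_2$ (where $\partial=\frac{\partial}{\partial z}$, $\bar\partial=\frac{\partial}{\partial\bar z}$), so that $df$ is a closed $\Gamma$-periodic $1$-form. A Dirac surface is a conformal immersion $f$ into $\mathbb{R}^3$ for which $H^2f^*g_{\mathbb{R}^3}$ is a metric of constant Gaussian curvature, $H$ being the mean curvature; as in the paper, $f$ here is simply the surface obtained by integrating $df$. *)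

theory Defs
  imports "HOL-Analysis.Analysis"
begin

section \<open>Quaternions\<close>

datatype quat = Quat (qre: real) (qi: real) (qj: real) (qk: real)

lemma quat_eq_iff: "x = y \<longleftrightarrow> qre x = qre y \<and> qi x = qi y \<and> qj x = qj y \<and> qk x = qk y"
  by (cases x; cases y) simp

instantiation quat :: ab_group_add
begin

definition "0 = Quat 0 0 0 0"
definition "x + y = Quat (qre x + qre y) (qi x + qi y) (qj x + qj y) (qk x + qk y)"
definition "x - y = Quat (qre x - qre y) (qi x - qi y) (qj x - qj y) (qk x - qk y)"
definition "- x = Quat (- qre x) (- qi x) (- qj x) (- qk x)"

instance
  by standard
    (simp_all add: zero_quat_def plus_quat_def minus_quat_def uminus_quat_def quat_eq_iff)

end

lemma quat_add_sel [simp]: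
  "qre 0 = 0" "qi 0 = 0" "qj 0 = 0" "qk 0 = 0"
  "qre (x + y) = qre x + qre y" "qi (x + y) = qi x + qi y"
  "qj (x + y) = qj x + qj y" "qk (x + y) = qk x + qk y"
  "qre (x - y) = qre x - qre y" "qi (x - y) = qi x - qi y"
  "qj (x - y) = qj x - qj y" "qk (x - y) = qk x - qk y"
  "qre (- x) = - qre x" "qi (- x) = - qi x" "qj (- x) = - qj x" "qk (- x) = - qk x"
  by (simp_all add: zero_quat_def plus_quat_def minus_quat_def uminus_quat_def)

instantiation quat :: ring_1
begin

definition "1 = Quat 1 0 0 0"
definition "x * y = Quat
  (qre x * qre y - qi x * qi y - qj x * qj y - qk x * qk y)
  (qre x * qi y + qi x * qre y + qj x * qk y - qk x * qj y)
  (qre x * qj y - qi x * qk y + qj x * qre y + qk x * qi y)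
  (qre x * qk y + qi x * qj y - qj x * qi y + qk x * qre y)"

instance
  by standard (simp_all add: one_quat_def times_quat_def quat_eq_iff algebra_simps)

end

lemma quat_mult_sel [simp]:
  "qre 1 = 1" "qi 1 = 0" "qj 1 = 0" "qk 1 = 0"
  "qre (x * y) = qre x * qre y - qi x * qi y - qj x * qj y - qk x * qk y"
  "qi (x * y) = qre x * qi y + qi x * qre y + qj x * qk y - qk x * qj y"
  "qj (x * y) = qre x * qj y - qi x * qk y + qj x * qre y + qk x * qi y"
  "qk (x * y) = qre x * qk y + qi x * qj y - qj x * qi y + qk x * qre y"
  by (simp_all add: one_quat_def times_quat_def)

instantiation quat :: real_algebra_1
begin

definition "r *\<^sub>R x = Quat (r * qre x) (r * qi x) (r * qj x) (r * qk x)"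

instance
  by standard (simp_all add: scaleR_quat_def quat_eq_iff algebra_simps)

end

lemma quat_scaleR_sel [simp]:
  "qre (r *\<^sub>R x) = r * qre x" "qi (r *\<^sub>R x) = r * qi x"
  "qj (r *\<^sub>R x) = r * qj x" "qk (r *\<^sub>R x) = r * qk x"
  by (simp_all add: scaleR_quat_def)

instantiation quat :: real_inner
begin

definition "inner x y = qre x * qre y + qi x * qi y + qj x * qj y + qk x * qk y"
definition "norm (x :: quat) = sqrt (inner x x)"
definition "sgn (x :: quat) = x /\<^sub>R norm x"
definition "dist (x :: quat) y = norm (x - y)"
definition "(uniformity :: (quat \<times> quat) filter) = (INF e\<in>{0<..}. principal {(x, y). dist x y < e})"
definition "open (U :: quat set) \<longleftrightarrow>
  (\<forall>x\<in>U. eventually (\<lambda>(x', y). x' = x \<longrightarrow> y \<in> U) uniformity)"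

instance
proof
  fix x y z :: quat and r :: real and U :: "quat set"
  show "inner x x = 0 \<longleftrightarrow> x = 0"
    by (simp add: inner_quat_def quat_eq_iff add_nonneg_eq_0_iff)
qed (simp_all add: inner_quat_def norm_quat_def sgn_quat_def dist_quat_def
       uniformity_quat_def open_quat_def algebra_simps)

end

lemma norm_quat: "norm x = sqrt ((qre x)\<^sup>2 + (qi x)\<^sup>2 + (qj x)\<^sup>2 + (qk x)\<^sup>2)" for x :: quat
  by (simp add: norm_quat_def inner_quat_def power2_eq_square)

instance quat :: real_normed_algebra_1
proof
  show "norm (1 :: quat) = 1"
    by (simp add: norm_quat)
  show "norm (x * y) \<le> norm x * norm y" for x y :: quat
    unfolding norm_quat real_sqrt_mult [symmetric]
    by (simp add: power2_eq_square algebra_simps)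
qed

definition quat_i :: quat where "quat_i = Quat 0 1 0 0"
definition quat_j :: quat where "quat_j = Quat 0 0 1 0"
definition quat_k :: quat where "quat_k = Quat 0 0 0 1"

lemma quat_units:
  "quat_i * quat_i = -1" "quat_j * quat_j = -1" "quat_k * quat_k = -1"
  "quat_i * quat_j = quat_k" "quat_j * quat_k = quat_i" "quat_k * quat_i = quat_j"
  by (simp_all add: quat_i_def quat_j_def quat_k_def quat_eq_iff)

definition qcnj :: "quat \<Rightarrow> quat" where
  "qcnj x = Quat (qre x) (- qi x) (- qj x) (- qk x)"

definition ImH :: "quat set" where
  "ImH = {x. x + qcnj x = 0}"

definition quat_of_complex :: "complex \<Rightarrow> quat" where
  "quat_of_complex z = of_real (Re z) + of_real (Im z) * quat_i"


section \<open>Lattices\<close>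

definition is_lattice :: "complex set \<Rightarrow> bool" where
  "is_lattice \<Gamma> \<longleftrightarrow> (\<exists>\<gamma>1 \<gamma>2. \<gamma>1 \<noteq> \<gamma>2 \<and> independent {\<gamma>1, \<gamma>2} \<and>
     \<Gamma> = {of_int m * \<gamma>1 + of_int n * \<gamma>2 | m n. True})"

text \<open>The inner product of \<^typ>\<open>complex\<close> is the Euclidean one,
  \<open>\<omega> \<bullet> \<gamma> = Re (\<omega> * cnj \<gamma>)\<close>.\<close>

definition dual_lattice :: "complex set \<Rightarrow> complex set" where
  "dual_lattice \<Gamma> = {\<omega>. \<forall>\<gamma>\<in>\<Gamma>. \<exists>n::int. \<omega> \<bullet> \<gamma> = 2 * pi * of_int n}"


section \<open>The surface differential\<close>

text \<open>For a lattice \<open>\<Gamma>\<close> the following set is finite (it is bounded and \<open>dual_lattice \<Gamma>\<close> is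
  discrete), so that the sums over it are not the default value \<open>0\<close> of infinite sums.\<close>

definition freqs :: "complex set \<Rightarrow> real \<Rightarrow> complex \<Rightarrow> complex set" where
  "freqs \<Gamma> \<mu> \<omega>0 = {\<omega> \<in> dual_lattice \<Gamma>. (cmod (\<omega> + \<omega>0))\<^sup>2 = \<mu>\<^sup>2}"

definition lam1 :: "complex set \<Rightarrow> real \<Rightarrow> complex \<Rightarrow> (complex \<Rightarrow> complex) \<Rightarrow> complex \<Rightarrow> complex" where
  "lam1 \<Gamma> \<mu> \<omega>0 a z =
     (\<Sum>\<omega>\<in>freqs \<Gamma> \<mu> \<omega>0. a \<omega> * exp (\<i> * of_real ((\<omega> + \<omega>0) \<bullet> z)))"

definition lam2 :: "complex set \<Rightarrow> real \<Rightarrow> complex \<Rightarrow> (complex \<Rightarrow> complex) \<Rightarrow> complex \<Rightarrow> complex" where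
  "lam2 \<Gamma> \<mu> \<omega>0 a z =
     - (\<Sum>\<omega>\<in>freqs \<Gamma> \<mu> \<omega>0.
          1 / of_real \<mu> * a \<omega> * (\<omega> + \<omega>0) * exp (\<i> * of_real ((\<omega> + \<omega>0) \<bullet> z)))"

text \<open>The quaternion-valued 1-form
  \<open>(j l1\<^sup>2 + l1 cnj l2) dz + (j l2\<^sup>2 - cnj l1 l2) d(cnj z)\<close> on the tangent vector \<open>v\<close>, that is,
  \<open>dz(v) = v\<close> and \<open>d(cnj z)(v) = cnj v\<close>. The order of the factors matters.\<close>

definition surface_form :: "complex \<Rightarrow> complex \<Rightarrow> complex \<Rightarrow> quat" where
  "surface_form l1 l2 v =
     (quat_j * quat_of_complex (l1\<^sup>2) + quat_of_complex (l1 * cnj l2)) * quat_of_complex v +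
     (quat_j * quat_of_complex (l2\<^sup>2) - quat_of_complex (cnj l1 * l2)) * quat_of_complex (cnj v)"

lemma surface_form_altdef:
  fixes l1 l2 v :: complex
  defines "l \<equiv> quat_of_complex l1 + quat_j * quat_of_complex l2"
  shows "surface_form l1 l2 v = qcnj l * quat_j * quat_of_complex v * l"
  unfolding l_def surface_form_def
  by (simp add: quat_eq_iff quat_of_complex_def of_real_def qcnj_def quat_i_def quat_j_def
      power2_eq_square algebra_simps)

lemma surface_form_in_ImH: "surface_form l1 l2 v \<in> ImH"
  by (simp add: ImH_def surface_form_def quat_eq_iff quat_of_complex_def of_real_def qcnj_def
      quat_i_def quat_j_def power2_eq_square algebra_simps)

end

theory Submission
  imports Defs
begin

text \<open>
  Expanding the products in \<open>df\<close> over pairs of frequencies, the pairs whose total frequency vanishes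
  give a real-linear form with constant coefficients. Since all \<open>\<omega> + \<omega>0\<close> lie on one circle, every
  other pair gives an exact term, namely a constant multiple of \<open>d(exp (\<i> * (w \<bullet> z)))\<close> with \<open>w\<close> in
  the dual lattice. Hence \<open>f (z + \<gamma>) - f z\<close> is the constant part evaluated at \<open>\<gamma>\<close>, and a real-linear
  form on the plane vanishes on a lattice only if its coefficients vanish.
\<close>

section \<open>Real-linear forms on a lattice and periodicity of primitives\<close>

text \<open>The two generators are a real basis of the plane, so a form vanishing on them vanishes
  everywhere; its values at \<open>1\<close> and \<open>\<i>\<close> then separate \<open>A\<close>
  from \<open>B\<close>.\<close>

lemma linear_form_zero_on_lattice_iff:
  fixes A B :: complex
  assumes "is_lattice \<Gamma>"
  shows "(\<forall>\<gamma>\<in>\<Gamma>. A * \<gamma> + B * cnj \<gamma> = 0) \<longleftrightarrow> A = 0 \<and> B = 0"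
proof
  assume zero: "\<forall>\<gamma>\<in>\<Gamma>. A * \<gamma> + B * cnj \<gamma> = 0"
  obtain \<gamma>1 \<gamma>2 where ne: "\<gamma>1 \<noteq> \<gamma>2" and ind: "independent {\<gamma>1, \<gamma>2}"
    and \<Gamma>: "\<Gamma> = {of_int m * \<gamma>1 + of_int n * \<gamma>2 | m n. True}"
    using assms unfolding is_lattice_def by blast
  have "\<gamma>1 = of_int 1 * \<gamma>1 + of_int 0 * \<gamma>2" "\<gamma>2 = of_int 0 * \<gamma>1 + of_int 1 * \<gamma>2"
    by simp_all
  then have "\<gamma>1 \<in> \<Gamma>" "\<gamma>2 \<in> \<Gamma>"
    unfolding \<Gamma> by blast+
  then have gen: "A * x + B * cnj x = 0" if "x \<in> {\<gamma>1, \<gamma>2}" for x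
    using zero that by blast
  have "UNIV \<subseteq> span {\<gamma>1, \<gamma>2}"
    by (rule card_ge_dim_independent) (use ind ne in auto)
  moreover have "linear (\<lambda>x. A * x + B * cnj x)"
    by (intro linearI) (simp_all add: algebra_simps scaleR_conv_of_real)
  ultimately have all: "A * x + B * cnj x = 0" for x
    using gen linear_eq_0_on_span[of "\<lambda>x. A * x + B * cnj x" "{\<gamma>1, \<gamma>2}" x] by blast
  have "A + B = 0" "\<i> * (A - B) = 0"
    using all[of 1] all[of \<i>] by (simp_all add: algebra_simps)
  then show "A = 0 \<and> B = 0"
    by (auto simp: add_eq_0_iff)
qed simp

lemma exp_dual_lattice_periodic:
  assumes "w \<in> dual_lattice \<Gamma>" "\<gamma> \<in> \<Gamma>"
  shows "exp (\<i> * of_real (w \<bullet> (z + \<gamma>))) = exp (\<i> * of_real (w \<bullet> z))"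
proof -
  obtain n :: int where "w \<bullet> \<gamma> = 2 * pi * of_int n"
    using assms unfolding dual_lattice_def by blast
  then have "\<i> * of_real (w \<bullet> (z + \<gamma>)) = \<i> * of_real (w \<bullet> z) + of_int (2 * n) * (of_real pi * \<i>)"
    by (simp add: inner_add_right algebra_simps)
  then show ?thesis
    by (auto simp: exp_eq)
qed

lemma has_derivative_exp_inner:
  fixes w :: complex
  shows "((\<lambda>z. exp (\<i> * of_real (w \<bullet> z))) has_derivative
    (\<lambda>v. exp (\<i> * of_real (w \<bullet> z)) * (\<i> * of_real (w \<bullet> v)))) (at z)"
  by (rule has_derivative_compose[OF _ DERIV_exp[unfolded has_field_derivative_def]])
    (auto intro!: derivative_eq_intros)

text \<open>The function \<open>h\<close> is a termwise primitive, so \<open>g - h\<close> is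
  constant. Lattice translations fix the exponentials in \<open>h\<close>, hence \<open>g\<close>
  grows by \<open>A * \<gamma> + B * cnj \<gamma>\<close> over \<open>\<gamma>\<close>. A frequency
  \<open>w k = 0\<close> is harmless: it adds a constant to \<open>h\<close> and nothing to the
  derivative.\<close>

lemma periodic_primitive_iff:
  fixes g :: "complex \<Rightarrow> complex" and w c :: "'i \<Rightarrow> complex"
  assumes "is_lattice \<Gamma>"
    and dual: "\<And>k. k \<in> I \<Longrightarrow> w k \<in> dual_lattice \<Gamma>"
    and dg: "\<And>z. (g has_derivative (\<lambda>v. A * v + B * cnj v +
               (\<Sum>k\<in>I. c k * of_real (w k \<bullet> v) * exp (\<i> * of_real (w k \<bullet> z))))) (at z)"
  shows "(\<forall>\<gamma>\<in>\<Gamma>. \<forall>z. g (z + \<gamma>) = g z) \<longleftrightarrow> A = 0 \<and> B = 0"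
proof -
  define h where "h = (\<lambda>z. A * z + B * cnj z +
    (\<Sum>k\<in>I. c k / \<i> * exp (\<i> * of_real (w k \<bullet> z))))"
  have dh: "(h has_derivative (\<lambda>v. A * v + B * cnj v +
      (\<Sum>k\<in>I. c k * of_real (w k \<bullet> v) * exp (\<i> * of_real (w k \<bullet> z))))) (at z)" for z
    unfolding h_def
    by (rule derivative_eq_intros has_derivative_exp_inner refl)+ (simp add: mult_ac)
  have "((\<lambda>z. g z - h z) has_derivative (\<lambda>v. 0)) (at z)" for z
    using has_derivative_diff[OF dg[of z] dh[of z]] by simp
  then obtain C where C: "g z - h z = C" for z
    using has_derivative_zero_constant[of UNIV "\<lambda>z. g z - h z"] by auto
  have "g (z + \<gamma>) = g z \<longleftrightarrow> A * \<gamma> + B * cnj \<gamma> = 0" if "\<gamma> \<in> \<Gamma>" for z \<gamma>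
  proof -
    have "exp (\<i> * of_real (w k \<bullet> (z + \<gamma>))) = exp (\<i> * of_real (w k \<bullet> z))" if "k \<in> I" for k
      using exp_dual_lattice_periodic[OF dual[OF that] \<open>\<gamma> \<in> \<Gamma>\<close>] .
    then have "(\<Sum>k\<in>I. c k / \<i> * exp (\<i> * of_real (w k \<bullet> (z + \<gamma>)))) =
        (\<Sum>k\<in>I. c k / \<i> * exp (\<i> * of_real (w k \<bullet> z)))"
      by (intro sum.cong) auto
    then have "h (z + \<gamma>) = h z + (A * \<gamma> + B * cnj \<gamma>)"
      unfolding h_def by (simp only: complex_cnj_add distrib_left) simp
    moreover have "g (z + \<gamma>) - h (z + \<gamma>) = g z - h z"
      by (simp only: C)
    ultimately show ?thesis
      by (simp add: algebra_simps)
  qed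
  then show ?thesis
    using linear_form_zero_on_lattice_iff[OF assms(1), of A B] by blast
qed

section \<open>The dual lattice and reflection of frequencies\<close>

lemma dual_lattice_add: "x \<in> dual_lattice \<Gamma> \<Longrightarrow> y \<in> dual_lattice \<Gamma> \<Longrightarrow> x + y \<in> dual_lattice \<Gamma>"
  unfolding dual_lattice_def
  by (simp add: inner_add_left) (metis distrib_left of_int_add)

lemma dual_lattice_minus: "x \<in> dual_lattice \<Gamma> \<Longrightarrow> - x \<in> dual_lattice \<Gamma>"
  unfolding dual_lattice_def
  by (simp add: inner_minus_left) (metis mult_minus_right of_int_minus)

text \<open>In terms of the shifted frequency \<open>\<omega> + \<omega>0\<close> the map is
  negation, which preserves the circle. It sends each frequency to the unique partner that cancels
  it in a product.\<close>

lemma freqs_reflect: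
  assumes "2 * \<omega>0 \<in> dual_lattice \<Gamma>" "\<omega> \<in> freqs \<Gamma> \<mu> \<omega>0"
  shows "- \<omega> - 2 * \<omega>0 \<in> freqs \<Gamma> \<mu> \<omega>0"
proof -
  have "- \<omega> + - (2 * \<omega>0) \<in> dual_lattice \<Gamma>"
    using assms by (intro dual_lattice_add dual_lattice_minus) (auto simp: freqs_def)
  moreover have "cmod (- \<omega> - 2 * \<omega>0 + \<omega>0) = cmod (\<omega> + \<omega>0)"
    using norm_minus_cancel[of "\<omega> + \<omega>0"] by (simp add: algebra_simps)
  ultimately show ?thesis
    using assms by (simp add: freqs_def)
qed

section \<open>Pairs of frequencies on one circle\<close>

lemma of_real_inner_complex: "2 * of_real (w \<bullet> v) = cnj w * v + w * cnj v" for w v :: complex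
  by (simp add: complex_eq_iff inner_complex_def)

text \<open>In the next two lemmas the last summand vanishes for \<open>p + q = 0\<close>, respectively \<open>p = q\<close>,
  because division by \<open>0\<close> yields \<open>0\<close>.\<close>

lemma circle_sum_term:
  fixes p q v m :: complex
  assumes "p * cnj p = m" "q * cnj q = m" "m \<noteq> 0"
  shows "v + p * q / m * cnj v = (if p + q = 0 then v - p\<^sup>2 / m * cnj v else 0) +
    2 / cnj (p + q) * of_real ((p + q) \<bullet> v)"
proof (cases "p + q = 0")
  case True
  then have "q = - p"
    by (simp add: add_eq_0_iff)
  then show ?thesis
    by (simp add: power2_eq_square)
next
  case False
  then have ne: "cnj (p + q) \<noteq> 0"
    by (metis complex_cnj_zero_iff)
  \<comment> \<open>The equal moduli enter here: they turn \<open>p * q / m\<close> into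
    \<open>(p + q) / cnj (p + q)\<close>, so that the form becomes a multiple of
    \<open>(p + q) \<bullet> v\<close>.\<close>
  have "p * q * cnj (p + q) = q * (p * cnj p) + p * (q * cnj q)"
    by (simp add: algebra_simps)
  then have "p * q * cnj (p + q) = (p + q) * m"
    unfolding assms by (simp add: algebra_simps)
  then have pq: "p * q / m = (p + q) / cnj (p + q)"
    by (simp only: frac_eq_eq[OF assms(3) ne])
  have "v + p * q / m * cnj v = (cnj (p + q) * v + (p + q) * cnj v) / cnj (p + q)"
    unfolding pq using ne by (simp add: add_divide_distrib distrib_right del: complex_cnj_add)
  then show ?thesis
    using False by (simp add: of_real_inner_complex)
qed

lemma circle_diff_term:
  fixes p q v m :: complex
  assumes "p * cnj p = m" "q * cnj q = m"
  shows "cnj q * v - p * cnj v = (if p = q then cnj p * v - p * cnj v else 0) +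
    2 * cnj q / cnj (p - q) * of_real ((p - q) \<bullet> v)"
proof (cases "p = q")
  case False
  then have ne: "cnj (p - q) \<noteq> 0"
    by simp
  \<comment> \<open>By the equal moduli, both sides are \<open>p * cnj q - m\<close>.\<close>
  have "cnj q * (p - q) = - p * cnj (p - q)"
    using assms by (simp add: algebra_simps)
  then have "cnj q * (cnj (p - q) * v + (p - q) * cnj v) = (cnj q * v - p * cnj v) * cnj (p - q)"
    by algebra
  then have "cnj q * v - p * cnj v = cnj q * (2 * of_real ((p - q) \<bullet> v)) / cnj (p - q)"
    unfolding of_real_inner_complex using ne by (simp add: eq_divide_eq del: complex_cnj_diff)
  then show ?thesis
    using False by simp
qed simp

section \<open>Complex components of imaginary quaternions\<close>

text \<open>This is the \<open>d\<close> in the splitting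
  \<open>x = quat_of_complex c + quat_j * quat_of_complex d\<close>; the minus sign comes from
  \<open>quat_j * quat_i = - quat_k\<close>. Inner products make bounded linearity
  immediate.\<close>

definition j_part :: "quat \<Rightarrow> complex" where
  "j_part x = of_real (x \<bullet> quat_j) - \<i> * of_real (x \<bullet> quat_k)"

text \<open>In the same splitting this is \<open>c\<close> without its real part, hence all of
  \<open>c\<close> on \<open>ImH\<close>.\<close>

definition i_part :: "quat \<Rightarrow> complex" where
  "i_part x = \<i> * of_real (x \<bullet> quat_i)"

lemma bounded_linear_j_part: "bounded_linear j_part"
  unfolding j_part_def
  by (intro bounded_linear_sub bounded_linear_mult_right[THEN bounded_linear_compose]
      bounded_linear_of_real[THEN bounded_linear_compose] bounded_linear_inner_left)

lemma bounded_linear_i_part: "bounded_linear i_part"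
  unfolding i_part_def
  by (intro bounded_linear_mult_right[THEN bounded_linear_compose]
      bounded_linear_of_real[THEN bounded_linear_compose] bounded_linear_inner_left)

lemma ImH_eq_iff:
  assumes "x \<in> ImH" "y \<in> ImH"
  shows "x = y \<longleftrightarrow> j_part x = j_part y \<and> i_part x = i_part y"
  using assms
  by (auto simp: ImH_def quat_eq_iff j_part_def i_part_def inner_quat_def quat_i_def quat_j_def
      quat_k_def qcnj_def complex_eq_iff)

lemma j_part_surface_form: "j_part (surface_form l1 l2 v) = l1\<^sup>2 * v + l2\<^sup>2 * cnj v"
  by (simp add: j_part_def surface_form_def inner_quat_def quat_i_def quat_j_def quat_k_def
      quat_of_complex_def of_real_def complex_eq_iff power2_eq_square algebra_simps)

text \<open>The complex component of the form is \<open>u - cnj u\<close> with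
  \<open>u = l1 * cnj l2 * v\<close>; it is purely imaginary, so \<open>i_part\<close> returns it
  unchanged.\<close>

lemma i_part_surface_form:
  "i_part (surface_form l1 l2 v) = l1 * cnj l2 * v - l2 * cnj l1 * cnj v"
  by (simp add: i_part_def surface_form_def inner_quat_def quat_i_def quat_j_def quat_k_def
      quat_of_complex_def of_real_def complex_eq_iff power2_eq_square algebra_simps)

section \<open>Fourier expansion of the two components of the differential\<close>

text \<open>Serves to collect the pairs with total frequency zero: each \<open>x\<close> has exactly
  one partner \<open>s x\<close>, its reflection in products of two phases and \<open>x\<close>
  itself when one phase is conjugated.\<close>

lemma sum_graph:
  assumes "finite S" "\<And>x. x \<in> S \<Longrightarrow> s x \<in> S"
  shows "(\<Sum>(x, y)\<in>S \<times> S. if y = s x then F x y else 0) = (\<Sum>x\<in>S. F x (s x))"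
  using assms by (simp add: sum.delta flip: sum.cartesian_product)

context
  fixes \<Gamma> :: "complex set" and \<mu> :: real and \<omega>0 :: complex and a :: "complex \<Rightarrow> complex"
  assumes mu: "\<mu> \<noteq> 0"
    and dual: "2 * \<omega>0 \<in> dual_lattice \<Gamma>"
    and fin: "finite (freqs \<Gamma> \<mu> \<omega>0)"
begin

lemma circle: "x \<in> freqs \<Gamma> \<mu> \<omega>0 \<Longrightarrow> (x + \<omega>0) * cnj (x + \<omega>0) = of_real (\<mu>\<^sup>2)"
  by (simp only: complex_norm_square[symmetric] freqs_def mem_Collect_eq flip: of_real_power)

text \<open>The squares of \<open>lam1\<close> and \<open>lam2\<close> are double sums with the same
  phases, and \<open>circle_sum_term\<close> splits each pair into a constant and an exact term. The
  constant terms come from reflected pairs and yield the second and third sums of the theorem, the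
  latter scaled by \<open>-1 / \<mu>\<^sup>2\<close>.\<close>

lemma j_part_expand:
  "j_part (surface_form (lam1 \<Gamma> \<mu> \<omega>0 a z) (lam2 \<Gamma> \<mu> \<omega>0 a z) v) =
    (\<Sum>x\<in>freqs \<Gamma> \<mu> \<omega>0. a x * a (- x - 2 * \<omega>0)) * v +
    - (\<Sum>x\<in>freqs \<Gamma> \<mu> \<omega>0. a x * a (- x - 2 * \<omega>0) * (x + \<omega>0)\<^sup>2) / of_real (\<mu>\<^sup>2) * cnj v +
    (\<Sum>k\<in>freqs \<Gamma> \<mu> \<omega>0 \<times> freqs \<Gamma> \<mu> \<omega>0.
      (a (fst k) * a (snd k) * (2 / cnj (fst k + snd k + 2 * \<omega>0))) *
      of_real ((fst k + snd k + 2 * \<omega>0) \<bullet> v) *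
      exp (\<i> * of_real ((fst k + snd k + 2 * \<omega>0) \<bullet> z)))"
  (is "?J = ?A * v + ?B * cnj v + ?T")
proof -
  define S where "S = freqs \<Gamma> \<mu> \<omega>0"
  define m where "m = complex_of_real (\<mu>\<^sup>2)"
  define p where "p = (\<lambda>x. x + \<omega>0)"
  define E where "E = (\<lambda>x. exp (\<i> * of_real (p x \<bullet> z)))"
  define c where "c = (\<lambda>x y. a x * a y * (2 / cnj (p x + p y)))"
  have p2: "p x + p y = x + y + 2 * \<omega>0" for x y
    by (simp add: p_def)
  have m: "m \<noteq> 0" "of_real \<mu> * of_real \<mu> = m"
    using mu by (simp_all add: m_def power2_eq_square)
  have E: "E x * E y = exp (\<i> * of_real ((p x + p y) \<bullet> z))" for x y
    by (simp add: E_def inner_add_left distrib_left exp_add)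
  have l1: "(lam1 \<Gamma> \<mu> \<omega>0 a z)\<^sup>2 = (\<Sum>(x, y)\<in>S \<times> S. a x * a y * (E x * E y))"
    by (simp add: lam1_def power2_eq_square sum_product sum.cartesian_product S_def E_def p_def
        mult_ac)
  have l2: "(lam2 \<Gamma> \<mu> \<omega>0 a z)\<^sup>2 = (\<Sum>(x, y)\<in>S \<times> S. a x * a y * (p x * p y / m) * (E x * E y))"
    by (simp add: lam2_def power2_eq_square sum_product sum.cartesian_product S_def E_def
        p_def mult_ac flip: m(2))
  have "?J = (\<Sum>(x, y)\<in>S \<times> S. a x * a y * (v + p x * p y / m * cnj v) * (E x * E y))"
    unfolding j_part_surface_form l1 l2
    by (simp add: sum_distrib_left sum_distrib_right case_prod_unfold algebra_simps sum.distrib)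
  also have "\<dots> = (\<Sum>(x, y)\<in>S \<times> S.
      (if y = - x - 2 * \<omega>0 then a x * a y * (v - (p x)\<^sup>2 / m * cnj v) else 0) +
      c x y * of_real ((p x + p y) \<bullet> v) * exp (\<i> * of_real ((p x + p y) \<bullet> z)))"
  proof (intro sum.cong refl, clarify)
    fix x y
    assume "x \<in> S" "y \<in> S"
    then have *: "v + p x * p y / m * cnj v =
        (if p x + p y = 0 then v - (p x)\<^sup>2 / m * cnj v else 0) +
        2 / cnj (p x + p y) * of_real ((p x + p y) \<bullet> v)"
      using circle m by (intro circle_sum_term) (simp_all add: S_def m_def p_def)
    have eq: "p x + p y = 0 \<longleftrightarrow> y = - x - 2 * \<omega>0"
      by (auto simp: p_def algebra_simps add_eq_0_iff)
    show "a x * a y * (v + p x * p y / m * cnj v) * (E x * E y) =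
      (if y = - x - 2 * \<omega>0 then a x * a y * (v - (p x)\<^sup>2 / m * cnj v) else 0) +
      c x y * of_real ((p x + p y) \<bullet> v) * exp (\<i> * of_real ((p x + p y) \<bullet> z))"
      unfolding * E eq[symmetric] c_def by (simp add: distrib_left distrib_right mult_ac)
  qed
  \<comment> \<open>Closure of \<open>freqs\<close> under reflection ensures that no partner falls
    outside \<open>S\<close>.\<close>
  also have "\<dots> = (\<Sum>x\<in>S. a x * a (- x - 2 * \<omega>0) * (v - (p x)\<^sup>2 / m * cnj v)) +
      (\<Sum>(x, y)\<in>S \<times> S. c x y * of_real ((p x + p y) \<bullet> v) *
        exp (\<i> * of_real ((p x + p y) \<bullet> z)))"
    using fin freqs_reflect[OF dual]
    by (subst sum_graph[symmetric])
      (simp_all add: S_def case_prod_unfold flip: sum.distrib)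
  also have "(\<Sum>x\<in>S. a x * a (- x - 2 * \<omega>0) * (v - (p x)\<^sup>2 / m * cnj v)) = ?A * v + ?B * cnj v"
    by (simp add: S_def p_def m_def right_diff_distrib sum_subtractf sum_distrib_left
        sum_distrib_right sum_divide_distrib mult_ac)
  also have "(\<Sum>(x, y)\<in>S \<times> S. c x y * of_real ((p x + p y) \<bullet> v) *
      exp (\<i> * of_real ((p x + p y) \<bullet> z))) = ?T"
    unfolding c_def p2 by (simp only: S_def case_prod_unfold)
  finally show ?thesis .
qed

text \<open>Conjugating one factor turns sums of frequencies into differences, so the constant terms
  come from the diagonal and carry \<open>a x * cnj (a x)\<close>. The coefficient of
  \<open>v\<close> is minus the conjugate of that of \<open>cnj v\<close>, so both encode the same
  condition.\<close>

lemma i_part_expand: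
  "i_part (surface_form (lam1 \<Gamma> \<mu> \<omega>0 a z) (lam2 \<Gamma> \<mu> \<omega>0 a z) v) =
    - cnj (\<Sum>x\<in>freqs \<Gamma> \<mu> \<omega>0. of_real ((cmod (a x))\<^sup>2) * (x + \<omega>0)) / of_real \<mu> * v +
    (\<Sum>x\<in>freqs \<Gamma> \<mu> \<omega>0. of_real ((cmod (a x))\<^sup>2) * (x + \<omega>0)) / of_real \<mu> * cnj v +
    (\<Sum>k\<in>freqs \<Gamma> \<mu> \<omega>0 \<times> freqs \<Gamma> \<mu> \<omega>0.
      (- (a (fst k) * cnj (a (snd k))) / of_real \<mu> *
        (2 * cnj (snd k + \<omega>0) / cnj (fst k - snd k))) *
      of_real ((fst k - snd k) \<bullet> v) *
      exp (\<i> * of_real ((fst k - snd k) \<bullet> z)))"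
  (is "?J = ?A * v + ?B * cnj v + ?T")
proof -
  define S where "S = freqs \<Gamma> \<mu> \<omega>0"
  define p where "p = (\<lambda>x. x + \<omega>0)"
  define E where "E = (\<lambda>x. exp (\<i> * of_real (p x \<bullet> z)))"
  define b where "b = (\<lambda>x y. - (a x * cnj (a y)) / of_real \<mu>)"
  define c where "c = (\<lambda>x y. b x y * (2 * cnj (p y) / cnj (p x - p y)))"
  have E: "E x * cnj (E y) = exp (\<i> * of_real ((p x - p y) \<bullet> z))" for x y
    by (simp add: E_def inner_diff_left right_diff_distrib exp_diff exp_cnj exp_minus divide_inverse)
  have l1: "lam1 \<Gamma> \<mu> \<omega>0 a z * cnj (lam2 \<Gamma> \<mu> \<omega>0 a z) =
      (\<Sum>(x, y)\<in>S \<times> S. b x y * cnj (p y) * (E x * cnj (E y)))"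
    by (simp add: lam1_def lam2_def sum_product)
      (simp add: sum.cartesian_product S_def E_def p_def b_def mult_ac case_prod_unfold
        flip: sum_negf)
  \<comment> \<open>In both products \<open>x\<close> indexes the unconjugated factor and
    \<open>y\<close> the conjugated one, so the two sums share the weight \<open>b x y\<close> and
    the phase and can be merged pairwise.\<close>
  have l2: "lam2 \<Gamma> \<mu> \<omega>0 a z * cnj (lam1 \<Gamma> \<mu> \<omega>0 a z) =
      (\<Sum>(x, y)\<in>S \<times> S. b x y * p x * (E x * cnj (E y)))"
    by (simp add: lam1_def lam2_def sum_product)
      (simp add: sum.cartesian_product S_def E_def p_def b_def mult_ac case_prod_unfold
        flip: sum_negf)
  have "?J = (\<Sum>(x, y)\<in>S \<times> S. b x y * (cnj (p y) * v - p x * cnj v) * (E x * cnj (E y)))"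
    unfolding i_part_surface_form l1 l2
    by (simp add: sum_distrib_left sum_distrib_right case_prod_unfold algebra_simps sum_subtractf)
  also have "\<dots> = (\<Sum>(x, y)\<in>S \<times> S.
      (if y = x then b x y * (cnj (p x) * v - p x * cnj v) else 0) +
      c x y * of_real ((p x - p y) \<bullet> v) * exp (\<i> * of_real ((p x - p y) \<bullet> z)))"
  proof (intro sum.cong refl, clarify)
    fix x y
    assume "x \<in> S" "y \<in> S"
    then have *: "cnj (p y) * v - p x * cnj v =
        (if p x = p y then cnj (p x) * v - p x * cnj v else 0) +
        2 * cnj (p y) / cnj (p x - p y) * of_real ((p x - p y) \<bullet> v)"
      using circle by (intro circle_diff_term) (simp_all add: S_def p_def)
    have eq: "p x = p y \<longleftrightarrow> y = x"
      by (auto simp: p_def)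
    show "b x y * (cnj (p y) * v - p x * cnj v) * (E x * cnj (E y)) =
      (if y = x then b x y * (cnj (p x) * v - p x * cnj v) else 0) +
      c x y * of_real ((p x - p y) \<bullet> v) * exp (\<i> * of_real ((p x - p y) \<bullet> z))"
      unfolding * E eq[symmetric] c_def by (simp add: distrib_left distrib_right mult_ac)
  qed
  also have "\<dots> = (\<Sum>x\<in>S. b x x * (cnj (p x) * v - p x * cnj v)) +
      (\<Sum>(x, y)\<in>S \<times> S. c x y * of_real ((p x - p y) \<bullet> v) *
        exp (\<i> * of_real ((p x - p y) \<bullet> z)))"
    using fin
    by (subst sum_graph[where s = "\<lambda>x. x", symmetric])
      (simp_all add: S_def case_prod_unfold flip: sum.distrib)
  also have "(\<Sum>x\<in>S. b x x * (cnj (p x) * v - p x * cnj v)) = ?A * v + ?B * cnj v"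
    by (simp add: S_def p_def b_def complex_norm_square right_diff_distrib sum_subtractf
        sum_distrib_left sum_distrib_right sum_divide_distrib sum_negf mult_ac
        del: of_real_power complex_cnj_add)
  also have "(\<Sum>(x, y)\<in>S \<times> S. c x y * of_real ((p x - p y) \<bullet> v) *
      exp (\<i> * of_real ((p x - p y) \<bullet> z))) = ?T"
    by (simp add: S_def p_def b_def c_def case_prod_unfold)
  finally show ?thesis .
qed

end

section \<open>Closing conditions for the surface\<close>

theorem theorem2:
  fixes \<Gamma> :: "complex set" and \<mu> :: real and \<omega>0 :: complex
    and a :: "complex \<Rightarrow> complex" and f :: "complex \<Rightarrow> quat"
  assumes lattice: "is_lattice \<Gamma>"
    and mu: "\<mu> \<noteq> 0"
    and omega0: "\<omega>0 \<in> (\<lambda>\<omega>. \<omega> / 2) ` dual_lattice \<Gamma>"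
    and f_ImH: "range f \<subseteq> ImH"
    and df: "\<And>z. (f has_derivative
               surface_form (lam1 \<Gamma> \<mu> \<omega>0 a z) (lam2 \<Gamma> \<mu> \<omega>0 a z)) (at z)"
  shows "(\<forall>\<gamma>\<in>\<Gamma>. \<forall>z. f (z + \<gamma>) = f z) \<longleftrightarrow>
      (\<Sum>\<omega>\<in>freqs \<Gamma> \<mu> \<omega>0. of_real ((cmod (a \<omega>))\<^sup>2) * (\<omega> + \<omega>0)) = 0 \<and>
      (\<Sum>\<omega>\<in>freqs \<Gamma> \<mu> \<omega>0. a \<omega> * a (- \<omega> - 2 * \<omega>0)) = 0 \<and>
      (\<Sum>\<omega>\<in>freqs \<Gamma> \<mu> \<omega>0. a \<omega> * a (- \<omega> - 2 * \<omega>0) * (\<omega> + \<omega>0)\<^sup>2) = 0"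
proof (cases "finite (freqs \<Gamma> \<mu> \<omega>0)")
  case False
  \<comment> \<open>Infinite sums are \<open>0\<close> by convention: here \<open>lam1\<close> and
    \<open>lam2\<close> vanish, \<open>f\<close> is constant, and both sides of the equivalence
    hold.\<close>
  then have "(f has_derivative (\<lambda>v. 0)) (at z)" for z
    using df[of z]
    by (simp add: lam1_def lam2_def surface_form_def[abs_def] quat_of_complex_def)
  then obtain C where "f z = C" for z
    using has_derivative_zero_constant[of UNIV f] by auto
  then show ?thesis
    using False by simp
next
  case fin: True
  have dual: "2 * \<omega>0 \<in> dual_lattice \<Gamma>"
    using omega0 by auto
  let ?I = "freqs \<Gamma> \<mu> \<omega>0 \<times> freqs \<Gamma> \<mu> \<omega>0"
  \<comment> \<open>Only \<open>2 * \<omega>0\<close> is known to lie in the dual lattice; this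
    suffices because \<open>\<omega>0\<close> occurs twice in a sum of shifted frequencies and
    cancels in a difference.\<close>
  have w_dual: "fst k + snd k + 2 * \<omega>0 \<in> dual_lattice \<Gamma>" "fst k - snd k \<in> dual_lattice \<Gamma>"
    if "k \<in> ?I" for k
    using that dual dual_lattice_add dual_lattice_add[OF _ dual_lattice_minus]
    by (auto simp: freqs_def)
  have "(\<forall>\<gamma>\<in>\<Gamma>. \<forall>z. f (z + \<gamma>) = f z) \<longleftrightarrow>
      (\<forall>\<gamma>\<in>\<Gamma>. \<forall>z. i_part (f (z + \<gamma>)) = i_part (f z)) \<and>
      (\<forall>\<gamma>\<in>\<Gamma>. \<forall>z. j_part (f (z + \<gamma>)) = j_part (f z))"
    using f_ImH ImH_eq_iff by (metis range_subsetD)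
  also note periodic_primitive_iff[OF lattice w_dual(2)
      bounded_linear.has_derivative[OF bounded_linear_i_part df,
        unfolded i_part_expand[OF mu dual fin]]]
  also note periodic_primitive_iff[OF lattice w_dual(1)
      bounded_linear.has_derivative[OF bounded_linear_j_part df,
        unfolded j_part_expand[OF mu dual fin]]]
  \<comment> \<open>Sign, conjugation and division by powers of \<open>\<mu>\<close> do not affect
    vanishing. Removing \<open>cnj_sum\<close> keeps the conjugate outside the sum, so that the two
    diagonal conditions reduce to one.\<close>
  finally show ?thesis
    using mu by (simp del: cnj_sum)
qed

end
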